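(* Let $(\mathcal{X},\mathcal{F},\sigma)$ be a probability space with an $\alpha$-homogeneous atomic filtration $(\mathcal{F}_n)_{n\ge 0}$, $0<\alpha\le 1/2$. Let $f\in L^1(\mathcal{X})$ be such that $S(f)\in L^\infty$. Then \[ \mathbb{E}\exp\Bigl(f-\frac{S(f)^2}{4\alpha}\Bigr)\le \exp(\mathbb{E} f). \]
   Context: An atomic filtration on a probability space $(\mathcal{X},\mathcal{F},\sigma)$ is an increasing sequence of $\sigma$-algebras $\mathcal{F}_n\subset\mathcal{F}$, $n\ge0$, with $\mathcal{F}_0=\{\varnothing,\mathcal{X}\}$, $\mathcal{F}$ generated by the $\mathcal{F}_n$, and such that for each $n$ there is a countable collection $\mathcal{D}_n$ of disjoint sets ("cubes") with every set of $\mathcal{F}_n$ a union of sets of $\mathcal{D}_n$. Write $\mathcal{D}=\bigcup_n\mathcal{D}_n$, $|A|=\sigma(A)$, and for $Q\in\mathcal{D}_n$ let $\operatorname{ch}Q=\{R\in\mathcal{D}_{n+1}:R\subset Q\}$. The filtration is $\alpha$-homogeneous ($0<\alpha\le1/2$) if $|Q'|\ge\alpha|Q|$ for every cube $Q$ and every $Q'\in\operatorname{ch}Q$. For measurable $A$ with $|A|>0$, $\langle f\rangle_A=|A|^{-1}\int_A f$ (and $\langle f\rangle_A=0$ if $|A|=0$); $\mathbb{E}f=\langle f\rangle_{\mathcal{X}}$. Let $\mathbf{E}_Q f=\langle f\rangle_Q\mathbf{1}_Q$, $\Delta_Q=\sum_{R\in\operatorname{ch}Q}\mathbf{E}_R-\mathbf{E}_Q$.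 The square function is $S f=\bigl(\sum_{Q\in\mathcal{D}}|\Delta_Q f|^2\bigr)^{1/2}$. *)

theory Defs
  imports "HOL-Probability.Probability"
begin

definition avg :: "'a measure \<Rightarrow> 'a set \<Rightarrow> ('a \<Rightarrow> real) \<Rightarrow> real" where
  "avg M A f = (if measure M A = 0 then 0 else (LINT x:A|M. f x) / measure M A)"

definition cubeE :: "'a measure \<Rightarrow> 'a set \<Rightarrow> ('a \<Rightarrow> real) \<Rightarrow> 'a \<Rightarrow> real" where
  "cubeE M Q f x = avg M Q f * indicator Q x"

definition children :: "(nat \<Rightarrow> 'a set set) \<Rightarrow> nat \<Rightarrow> 'a set \<Rightarrow> 'a set set" where
  "children D n Q = {R \<in> D (Suc n). R \<subseteq> Q}"

definition mdiff :: "'a measure \<Rightarrow> (nat \<Rightarrow> 'a set set) \<Rightarrow> nat \<Rightarrow> 'a set \<Rightarrow> ('a \<Rightarrow> real) \<Rightarrow> 'a \<Rightarrow> real" where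
  "mdiff M D n Q f x = (\<Sum>\<^sub>\<infinity>R\<in>children D n Q. cubeE M R f x) - cubeE M Q f x"

definition sq_sum :: "'a measure \<Rightarrow> (nat \<Rightarrow> 'a set set) \<Rightarrow> ('a \<Rightarrow> real) \<Rightarrow> 'a \<Rightarrow> ennreal" where
  "sq_sum M D f x = (\<Sum>n. \<integral>\<^sup>+ Q. ennreal ((mdiff M D n Q f x)\<^sup>2) \<partial>count_space (D n))"

definition square_fun :: "'a measure \<Rightarrow> (nat \<Rightarrow> 'a set set) \<Rightarrow> ('a \<Rightarrow> real) \<Rightarrow> 'a \<Rightarrow> real" where
  "square_fun M D f x = sqrt (enn2real (sq_sum M D f x))"

definition atomic_filtration :: "'a measure \<Rightarrow> (nat \<Rightarrow> 'a set set) \<Rightarrow> (nat \<Rightarrow> 'a set set) \<Rightarrow> bool" where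
  "atomic_filtration M F D \<longleftrightarrow>
     (\<forall>n. sigma_algebra (space M) (F n) \<and> F n \<subseteq> sets M) \<and>
     (\<forall>n. F n \<subseteq> F (Suc n)) \<and>
     F 0 = {{}, space M} \<and>
     sets M = sigma_sets (space M) (\<Union>n. F n) \<and>
     (\<forall>n. countable (D n) \<and> disjoint (D n) \<and> D n \<subseteq> F n \<and>
          (\<forall>A\<in>F n. \<exists>C\<subseteq>D n. A = \<Union>C))"

definition homogeneous :: "'a measure \<Rightarrow> (nat \<Rightarrow> 'a set set) \<Rightarrow> real \<Rightarrow> bool" where
  "homogeneous M D \<alpha> \<longleftrightarrow>
     (\<forall>n. \<forall>Q\<in>D n. \<forall>R\<in>children D n Q. measure M R \<ge> \<alpha> * measure M Q)"

end

theory Submission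
  imports Defs
begin

text \<open>
  The heart of the matter is a one-step inequality: if a mean-zero random variable \<open>X\<close> takes
  finitely many values, each with probability at least \<open>\<alpha>\<close>, then
  \<open>E exp (X - X\<^sup>2 / (4 \<alpha>)) \<le> 1\<close>. A convexity argument reduces it to variables with two values, of
  probabilities \<open>\<alpha>\<close> and \<open>1 - \<alpha>\<close>; there it is checked at the critical points of the left-hand side
  as a function of the size of \<open>X\<close>, where it becomes a polynomial inequality.

  Applied on every cube, the one-step inequality shows that \<open>E exp (f\<^sub>n - S\<^sub>n\<^sup>2 / (4 \<alpha>))\<close> is
  nonincreasing in \<open>n\<close>, where \<open>f\<^sub>n\<close> is the conditional expectation of \<open>f\<close> and \<open>S\<^sub>n\<close> the
  square function truncated to the first \<open>n\<close> generations. Since \<open>f\<^sub>n\<close> tends to \<open>f\<close> in \<open>L\<^sup>1\<close>, a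
  subsequence converges almost everywhere, and Fatou's lemma concludes.
\<close>

section \<open>The one-step inequality\<close>

text \<open>The bound ln (1 - z) \<le> - z - z^2 / 2 in multiplied form, which also makes sense for
  z \<ge> 1. The left-hand side decreases because its derivative is - x^2 times an
  exponential.\<close>

lemma one_minus_mult_exp_le:
  fixes z :: real
  assumes "0 \<le> z"
  shows "(1 - z) * exp (z + z\<^sup>2 / 2) \<le> 1"
proof -
  have "(\<lambda>z::real. (1 - z) * exp (z + z\<^sup>2 / 2)) z \<le> (\<lambda>z. (1 - z) * exp (z + z\<^sup>2 / 2)) 0"
  proof (rule DERIV_nonpos_imp_nonincreasing[OF assms])
    fix x :: real
    have "((\<lambda>z. (1 - z) * exp (z + z\<^sup>2 / 2)) has_real_derivative
            - (x\<^sup>2 * exp (x + x\<^sup>2 / 2))) (at x)"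
      by (auto intro!: derivative_eq_intros simp: algebra_simps power2_eq_square)
    then show "\<exists>y. ((\<lambda>z. (1 - z) * exp (z + z\<^sup>2 / 2)) has_real_derivative y) (at x) \<and> y \<le> 0"
      by (intro exI conjI) auto
  qed
  then show ?thesis by simp
qed

text \<open>The left-hand side is the value at a critical point \<open>s\<close> of the function bounded in the
  next lemma, which need not be monotone on the unit interval.\<close>

lemma two_point_critical_bound:
  fixes \<alpha> s :: real
  assumes a: "0 < \<alpha>" "\<alpha> \<le> 1/2" and s: "0 \<le> s" "s \<le> 1"
  shows "exp (\<alpha> * (2 * s - s\<^sup>2)) * (1 - \<alpha> * s / (\<alpha> + (1 - \<alpha>) * s)) \<le> 1"
proof -
  define B where "B = \<alpha> + (1 - \<alpha>) * s"
  define z where "z = \<alpha> * s / B"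
  have B: "B > 0" unfolding B_def using a s by (simp add: add_pos_nonneg)
  have "\<alpha> * s \<le> (1 - \<alpha>) * s" using a s by (intro mult_right_mono) auto
  then have "\<alpha> * s \<le> B" using a by (simp add: B_def)
  then have z: "0 \<le> z" "z \<le> 1"
    using a s B by (auto simp: z_def)
  have cubic: "0 \<le> 2 - s - 4 * s\<^sup>2 + 4 * s ^ 3"
  proof -
    \<comment> \<open>The square is centred at 3/4, close to the minimum point of the cubic on the
      unit interval; the linear remainder is positive there.\<close>
    have "2 - s - 4 * s\<^sup>2 + 4 * s ^ 3 = 4 * (s + 1/2) * (s - 3/4)\<^sup>2 + (7/8 - s/4)"
      by (simp add: power2_eq_square power3_eq_cube field_simps)
    moreover have "0 \<le> 4 * (s + 1/2) * (s - 3/4)\<^sup>2" using s by simp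
    ultimately show ?thesis using s by linarith
  qed
  \<comment> \<open>Expanding in powers of \<open>(1 - 2 * \<alpha>) / \<alpha>\<close> makes all coefficients nonnegative.\<close>
  have "2 * B + \<alpha> * s - 2 * (2 - s) * B\<^sup>2 =
      2 * s * (1 - s)\<^sup>2 * (1 - 2 * \<alpha>)\<^sup>2
      + (2 - s - 4 * s\<^sup>2 + 4 * s ^ 3) * (\<alpha> * (1 - 2 * \<alpha>)) + 2 * s ^ 3 * \<alpha>\<^sup>2"
    unfolding B_def by algebra
  also have "\<dots> \<ge> 0" using a s cubic by simp
  \<comment> \<open>Multiplying by \<alpha> * s / (2 * B^2) turns this into \<alpha> * (2 * s - s^2)
    \<le> z + z^2 / 2.\<close>
  finally have "2 * (2 - s) * B\<^sup>2 \<le> 2 * B + \<alpha> * s" by simp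
  then have "(2 - s) \<le> 1 / B + \<alpha> * s / (2 * B\<^sup>2)"
    using B by (simp add: field_simps power2_eq_square)
  then have "\<alpha> * s * (2 - s) \<le> \<alpha> * s * (1 / B + \<alpha> * s / (2 * B\<^sup>2))"
    using a s by (intro mult_left_mono) auto
  then have "\<alpha> * (2 * s - s\<^sup>2) \<le> z + z\<^sup>2 / 2"
    unfolding z_def by (simp add: power2_eq_square algebra_simps)
  then have "exp (\<alpha> * (2 * s - s\<^sup>2)) * (1 - z) \<le> exp (z + z\<^sup>2 / 2) * (1 - z)"
    using z by (intro mult_right_mono) auto
  with one_minus_mult_exp_le[OF z(1)] show ?thesis
    by (simp add: z_def B_def mult.commute)
qed

text \<open>The left-hand side is the mean of \<open>gexp \<alpha>\<close>, defined below, for a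
  centred variable equal to - 2 (1 - \<alpha>) s with probability \<alpha> and to 2 \<alpha> s
  otherwise. At s = 1 the positive value reaches the maximum point of \<open>gexp \<alpha>\<close>.
  A maximum over s lies at 0, where the mean is 1, or at an interior critical point.\<close>

lemma two_point_le_one_on_unit_interval:
  fixes \<alpha> s :: real
  assumes a: "0 < \<alpha>" "\<alpha> \<le> 1/2" and s: "0 \<le> s" "s \<le> 1"
  shows "\<alpha> * exp (- 2 * (1 - \<alpha>) * s - (1 - \<alpha>)\<^sup>2 * s\<^sup>2 / \<alpha>)
       + (1 - \<alpha>) * exp (\<alpha> * (2 * s - s\<^sup>2)) \<le> 1"
proof -
  define U where "U s = exp (- 2 * (1 - \<alpha>) * s - (1 - \<alpha>)\<^sup>2 * s\<^sup>2 / \<alpha>)" for s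
  define V where "V s = exp (\<alpha> * (2 * s - s\<^sup>2))" for s
  define G where "G s = \<alpha> * U s + (1 - \<alpha>) * V s" for s
  define G' where "G' s = 2 * (1 - \<alpha>) * (\<alpha> * (1 - s) * V s - (\<alpha> + (1 - \<alpha>) * s) * U s)" for s
  have deriv: "(G has_real_derivative G' s) (at s)" for s
    unfolding G_def U_def V_def G'_def using a
    by (auto intro!: derivative_eq_intros simp: field_simps power2_eq_square)
  have "continuous_on {0..1} G"
    by (meson DERIV_isCont continuous_at_imp_continuous_on deriv)
  then obtain m where m: "m \<in> {0..1}" and max: "\<And>y. y \<in> {0..1} \<Longrightarrow> G y \<le> G m"
    using continuous_attains_sup[of "{0..1::real}" G] by auto
  have "G m \<le> 1"
  proof (cases "m = 0 \<or> m = 1")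
    case True
    \<comment> \<open>The derivative at 1 is negative, so values just left of 1 are larger.\<close>
    have "m \<noteq> 1"
    proof
      assume "m = 1"
      have "G' 1 < 0" using a by (simp add: G'_def U_def mult_pos_pos)
      from DERIV_neg_dec_left[OF deriv this] obtain d where
        d: "d > 0" "\<And>h. h > 0 \<Longrightarrow> h < d \<Longrightarrow> G 1 < G (1 - h)" by auto
      define h where "h = min (d/2) (1/2)"
      have "G 1 < G (1 - h)" using d by (intro d(2)) (auto simp: h_def)
      moreover have "G (1 - h) \<le> G m" using d by (intro max) (auto simp: h_def)
      ultimately show False using \<open>m = 1\<close> by simp
    qed
    with True have "m = 0" by simp
    then show ?thesis by (simp add: G_def U_def V_def)
  next
    case False
    with m have m01: "0 < m" "m < 1" by auto
    define B where "B = \<alpha> + (1 - \<alpha>) * m"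
    have B: "B > 0" unfolding B_def using a m01 by (simp add: add_pos_nonneg)
    have "G' m = 0"
      using m01 by (intro DERIV_local_max[OF deriv, of "min m (1 - m)"] allI impI max)
        (auto simp: abs_real_def split: if_splits)
    then have crit: "B * U m = \<alpha> * (1 - m) * V m"
      using a by (simp add: G'_def B_def)
    \<comment> \<open>The critical equation eliminates \<open>U m\<close> and leaves the quantity of
      \<open>two_point_critical_bound\<close>.\<close>
    have "B * G m = \<alpha> * (B * U m) + (1 - \<alpha>) * B * V m"
      by (simp add: G_def algebra_simps)
    also have "\<dots> = V m * (B - \<alpha> * m)"
      unfolding crit by (simp add: B_def algebra_simps)
    also have "\<dots> = B * (V m * (1 - \<alpha> * m / B))"
      using B by (simp add: field_simps)
    finally have "G m = V m * (1 - \<alpha> * m / B)" using B by simp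
    also have "\<dots> \<le> 1"
      unfolding V_def B_def using two_point_critical_bound[OF a, of m] m01 by simp
    finally show ?thesis .
  qed
  with max[of s] s show ?thesis by (simp add: G_def U_def V_def)
qed

text \<open>The factor by which an increment x of f_n multiplies exp (f_n - S_n^2 / (4
  \<alpha>)).\<close>

definition gexp :: "real \<Rightarrow> real \<Rightarrow> real" where
  "gexp \<alpha> x = exp (x - x\<^sup>2 / (4 * \<alpha>))"

lemma gexp_0 [simp]: "gexp \<alpha> 0 = 1"
  by (simp add: gexp_def)

lemma gexp_le_max:
  assumes "0 < \<alpha>"
  shows "gexp \<alpha> x \<le> gexp \<alpha> (2 * \<alpha>)"
proof -
  have "0 \<le> (x - 2 * \<alpha>)\<^sup>2 / (4 * \<alpha>)" using assms by simp
  also have "\<dots> = (2 * \<alpha> - (2 * \<alpha>)\<^sup>2 / (4 * \<alpha>)) - (x - x\<^sup>2 / (4 * \<alpha>))"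
    using assms by (simp add: field_simps power2_eq_square)
  finally show ?thesis by (simp add: gexp_def)
qed

text \<open>Below the cap 2 * \<alpha> this is the previous bound in the variable s. Once the cap is
  active, only the term at - T still varies, and it decreases in T, so the case s = 1
  suffices.\<close>

lemma gexp_two_point:
  assumes a: "0 < \<alpha>" "\<alpha> \<le> 1/2" and "0 \<le> T"
  shows "\<alpha> * gexp \<alpha> (- T) + (1 - \<alpha>) * gexp \<alpha> (min (\<alpha> * T / (1 - \<alpha>)) (2 * \<alpha>)) \<le> 1"
proof -
  define s where "s = T / (2 * (1 - \<alpha>))"
  have s0: "0 \<le> s" and T: "T = 2 * (1 - \<alpha>) * s" using assms by (auto simp: s_def)
  have U: "gexp \<alpha> (- (2 * (1 - \<alpha>) * s)) = exp (- 2 * (1 - \<alpha>) * s - (1 - \<alpha>)\<^sup>2 * s\<^sup>2 / \<alpha>)" for s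
    using a by (simp add: gexp_def field_simps power2_eq_square)
  have V: "gexp \<alpha> (2 * \<alpha> * s) = exp (\<alpha> * (2 * s - s\<^sup>2))" for s
    using a by (simp add: gexp_def field_simps power2_eq_square)
  have x: "\<alpha> * T / (1 - \<alpha>) = 2 * \<alpha> * s" using a by (simp add: T field_simps)
  show ?thesis
  proof (cases "s \<le> 1")
    case True
    then have "min (\<alpha> * T / (1 - \<alpha>)) (2 * \<alpha>) = 2 * \<alpha> * s"
      unfolding x using a by (simp add: min_def mult_le_cancel_left1)
    then show ?thesis
      using two_point_le_one_on_unit_interval[OF a s0 True] U V T by simp
  next
    case False
    then have m: "min (\<alpha> * T / (1 - \<alpha>)) (2 * \<alpha>) = 2 * \<alpha> * 1"
      unfolding x using a by (simp add: min_def mult_le_cancel_left1)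
    have "(1 - \<alpha>)\<^sup>2 * 1\<^sup>2 / \<alpha> \<le> (1 - \<alpha>)\<^sup>2 * s\<^sup>2 / \<alpha>"
      using a False by (intro divide_right_mono mult_left_mono power_mono) auto
    moreover have "(1 - \<alpha>) * 1 \<le> (1 - \<alpha>) * s"
      using a False by (intro mult_left_mono) auto
    ultimately have "gexp \<alpha> (- T) \<le> gexp \<alpha> (- (2 * (1 - \<alpha>) * 1))"
      unfolding T U exp_le_cancel_iff by argo
    then have "\<alpha> * gexp \<alpha> (- T) \<le> \<alpha> * gexp \<alpha> (- (2 * (1 - \<alpha>) * 1))"
      using a by simp
    then show ?thesis
      using two_point_le_one_on_unit_interval[OF a, of 1] U[of 1] V[of 1] m by simp
  qed
qed

lemma gexp_deriv:
  assumes "0 < \<alpha>"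
  shows "(gexp \<alpha> has_real_derivative (1 - x / (2 * \<alpha>)) * gexp \<alpha> x) (at x)"
  unfolding gexp_def using assms
  by (auto intro!: derivative_eq_intros simp: field_simps)

lemma gexp_deriv2:
  assumes "0 < \<alpha>"
  shows "((\<lambda>x. (1 - x / (2 * \<alpha>)) * gexp \<alpha> x) has_real_derivative
           ((1 - x / (2 * \<alpha>))\<^sup>2 - 1 / (2 * \<alpha>)) * gexp \<alpha> x) (at x)"
  using assms
  by (auto intro!: derivative_eq_intros gexp_deriv simp: power2_eq_square field_simps)

text \<open>On \<open>[0, \<infinity>)\<close> the concave majorant of \<open>gexp \<alpha>\<close> is obtained by freezing it at its maximum
  point \<open>2 * \<alpha>\<close>.\<close>

lemma gexp_support_line:
  assumes a: "0 < \<alpha>" "\<alpha> \<le> 1/2" and \<xi>: "0 \<le> \<xi>"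
  obtains l where "\<And>x. 0 \<le> x \<Longrightarrow> gexp \<alpha> x \<le> gexp \<alpha> (min \<xi> (2 * \<alpha>)) + l * (x - \<xi>)"
proof (cases "\<xi> \<le> 2 * \<alpha>")
  \<comment> \<open>The line passes through the global maximum value, so slope 0 works.\<close>
  case False
  with gexp_le_max[OF a(1)] show ?thesis by (intro that[of 0]) simp
next
  case True
  define l where "l = (1 - \<xi> / (2 * \<alpha>)) * gexp \<alpha> \<xi>"
  have l: "l \<ge> 0" using a True by (simp add: l_def gexp_def)
  have tangent: "gexp \<alpha> x \<le> gexp \<alpha> \<xi> + l * (x - \<xi>)" if "x \<in> {0..2 * \<alpha>}" for x
  proof -
    \<comment> \<open>The tangent bound for the convex function - gexp: on this interval (1 - y / (2
      \<alpha>))^2 \<le> 1 \<le> 1 / (2 \<alpha>), so \<open>gexp \<alpha>\<close> is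
      concave.\<close>
    have "- ((1 - \<xi> / (2 * \<alpha>)) * gexp \<alpha> \<xi>) * (x - \<xi>) \<le> - gexp \<alpha> x - - gexp \<alpha> \<xi>"
    proof (rule f''_imp_f'[of "{0..2 * \<alpha>}" _ "\<lambda>x. - ((1 - x / (2 * \<alpha>)) * gexp \<alpha> x)"
          "\<lambda>x. - (((1 - x / (2 * \<alpha>))\<^sup>2 - 1 / (2 * \<alpha>)) * gexp \<alpha> x)"])
      fix y assume "y \<in> {0..2 * \<alpha>}"
      then have "\<bar>1 - y / (2 * \<alpha>)\<bar> \<le> 1" using a by (simp add: abs_le_iff field_simps)
      then have "(1 - y / (2 * \<alpha>))\<^sup>2 \<le> 1" by (simp add: abs_square_le_1)
      also have "1 \<le> 1 / (2 * \<alpha>)" using a by (simp add: field_simps)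
      finally show "0 \<le> - (((1 - y / (2 * \<alpha>))\<^sup>2 - 1 / (2 * \<alpha>)) * gexp \<alpha> y)"
        by (simp add: gexp_def mult_nonpos_nonneg)
    qed (use a that \<xi> True in \<open>auto intro!: DERIV_minus gexp_deriv gexp_deriv2\<close>)
    then show ?thesis by (simp add: l_def)
  qed
  have "gexp \<alpha> x \<le> gexp \<alpha> \<xi> + l * (x - \<xi>)" if "0 \<le> x" for x
  proof (cases "x \<le> 2 * \<alpha>")
    case True
    with that tangent show ?thesis by simp
  next
    case False
    \<comment> \<open>Past the maximum point, compare with the line at 2 * \<alpha>; from there on
      the line does not decrease.\<close>
    have "gexp \<alpha> x \<le> gexp \<alpha> \<xi> + l * (2 * \<alpha> - \<xi>)"
      using gexp_le_max[OF a(1), of x] tangent[of "2 * \<alpha>"] a by simp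
    moreover have "l * (2 * \<alpha> - \<xi>) \<le> l * (x - \<xi>)"
      using l False by (intro mult_left_mono) auto
    ultimately show ?thesis by simp
  qed
  with True show ?thesis by (intro that[of l]) (simp add: min_def)
qed

text \<open>Since \<alpha> \<le> 1/2, the exponent is at most x - x^2 / 2 \<le> ln (1 + x). This
  handles the positive values when the negative ones give no excess over their linear bound.\<close>

lemma gexp_le_one_plus:
  assumes a: "0 < \<alpha>" "\<alpha> \<le> 1/2" and "0 \<le> x"
  shows "gexp \<alpha> x \<le> 1 + x"
proof -
  have "x\<^sup>2 / 2 \<le> x\<^sup>2 / (4 * \<alpha>)" using a by (intro divide_left_mono) auto
  then have "x - x\<^sup>2 / (4 * \<alpha>) \<le> x - x\<^sup>2 / 2" by simp
  also have "\<dots> \<le> ln (1 + x)"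
  proof -
    have "(\<lambda>x. ln (1 + x) - x + x\<^sup>2 / 2) 0 \<le> (\<lambda>x::real. ln (1 + x) - x + x\<^sup>2 / 2) x"
    proof (rule DERIV_nonneg_imp_nondecreasing[OF assms(3)])
      fix y :: real assume "0 \<le> y"
      then have "((\<lambda>x. ln (1 + x) - x + x\<^sup>2 / 2) has_real_derivative y\<^sup>2 / (1 + y)) (at y)"
        by (auto intro!: derivative_eq_intros simp: field_simps power2_eq_square)
      then show "\<exists>D. ((\<lambda>x. ln (1 + x) - x + x\<^sup>2 / 2) has_real_derivative D) (at y) \<and> 0 \<le> D"
        using \<open>0 \<le> y\<close> by (intro exI[of _ "y\<^sup>2 / (1 + y)"] conjI) auto
    qed
    then show ?thesis by simp
  qed
  finally have "exp (x - x\<^sup>2 / (4 * \<alpha>)) \<le> exp (ln (1 + x))" by simp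
  with assms(3) show ?thesis by (simp add: gexp_def)
qed

text \<open>\<open>y \<mapsto> gexp \<alpha> (- y) - 1 + y\<close> vanishes to first order at 0 and is concave, then convex.\<close>

lemma gexp_neg_ratio:
  assumes a: "0 < \<alpha>" "\<alpha> \<le> 1/2" and y: "0 < y" "y \<le> T"
  shows "gexp \<alpha> (- y) - 1 + y \<le> y * max 0 ((gexp \<alpha> (- T) - 1 + T) / T)"
proof -
  define k where "k y = gexp \<alpha> (- y) - 1 + y" for y
  define k' where "k' y = 1 - (1 + y / (2 * \<alpha>)) * gexp \<alpha> (- y)" for y
  define k'' where "k'' y = ((1 + y / (2 * \<alpha>))\<^sup>2 - 1 / (2 * \<alpha>)) * gexp \<alpha> (- y)" for y
  \<comment> \<open>The inflection point of \<open>k\<close> on the half-line y \<ge> 0, where 1 + b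
    / (2 \<alpha>) = sqrt (1 / (2 \<alpha>)); it is nonnegative because \<alpha> \<le> 1/2.\<close>
  define b where "b = 2 * \<alpha> * (sqrt (1 / (2 * \<alpha>)) - 1)"
  have k1: "(k has_real_derivative k' x) (at x)" for x
    unfolding k_def k'_def using a
    by (auto intro!: derivative_eq_intros DERIV_chain2[OF gexp_deriv] simp: field_simps)
  have k2: "(k' has_real_derivative k'' x) (at x)" for x
    unfolding k''_def k'_def using a
    by (auto intro!: derivative_eq_intros DERIV_chain2[OF gexp_deriv]
          simp: field_simps power2_eq_square)
  have root: "1 \<le> sqrt (1 / (2 * \<alpha>))" using a by (simp add: field_simps)
  have b: "0 \<le> b" using a root by (simp add: b_def)
  have bsq: "(1 + b / (2 * \<alpha>))\<^sup>2 = 1 / (2 * \<alpha>)"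
    using a by (simp add: b_def field_simps)
  have concave: "k'' x \<le> 0" if "0 \<le> x" "x \<le> b" for x
  proof -
    have "(1 + x / (2 * \<alpha>))\<^sup>2 \<le> (1 + b / (2 * \<alpha>))\<^sup>2"
      using that a by (intro power_mono add_left_mono divide_right_mono) auto
    then show ?thesis by (simp add: k''_def bsq gexp_def mult_nonpos_nonneg)
  qed
  have convex: "k'' x \<ge> 0" if "b \<le> x" for x
  proof -
    have "(1 + b / (2 * \<alpha>))\<^sup>2 \<le> (1 + x / (2 * \<alpha>))\<^sup>2"
      using that a b by (intro power_mono add_left_mono divide_right_mono) auto
    then show ?thesis by (simp add: k''_def bsq gexp_def)
  qed
  have k0: "k x \<le> 0" if "0 \<le> x" "x \<le> b" for x
  proof -
    \<comment> \<open>Both \<open>k\<close> and \<open>k'\<close> vanish at 0, so concavity puts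
      \<open>k\<close> below its tangent there, the zero line.\<close>
    have "- k' 0 * (x - 0) \<le> - k x - - k 0"
      by (rule f''_imp_f'[of "{0..b}" _ "\<lambda>x. - k' x" "\<lambda>x. - k'' x"])
        (use that b concave in \<open>auto intro!: DERIV_minus k1 k2\<close>)
    then show ?thesis by (simp add: k_def k'_def)
  qed
  show ?thesis
  proof (cases "y \<le> b")
    case True
    with k0[of y] y show ?thesis
      by (simp add: k_def) (smt (verit) max.cobounded1 mult_nonneg_nonneg)
  next
    case False
    have "convex_on {b..} k"
      by (rule f''_ge0_imp_convex[of _ _ k' k'']) (auto intro!: k1 k2 convex)
    define u where "u = (y - b) / (T - b)"
    have u: "0 \<le> u" "u \<le> 1" and "u * (T - b) = y - b"
      using False y by (auto simp: u_def)
    then have y_eq: "y = (1 - u) * b + u * T" by (simp add: algebra_simps)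
    \<comment> \<open>Convexity bounds \<open>k y\<close> by the chord from \<open>b\<close> to
      \<open>T\<close>; then \<open>k b\<close> \<le> 0 is dropped and u * T \<le> y is
      used.\<close>
    have "k ((1 - u) *\<^sub>R b + u *\<^sub>R T) \<le> (1 - u) * k b + u * k T"
      using \<open>convex_on {b..} k\<close> u False y by (intro convex_onD) auto
    also have "\<dots> \<le> u * k T"
      using k0[of b] b u by (simp add: mult_nonneg_nonpos)
    finally have "k y \<le> u * k T" using y_eq by simp
    also have "\<dots> \<le> u * (T * max 0 (k T / T))"
      using u y by (intro mult_left_mono) (auto simp: max_def field_simps)
    also have "\<dots> = (u * T) * max 0 (k T / T)" by simp
    also have "\<dots> \<le> y * max 0 (k T / T)"
      using u b y_eq by (intro mult_right_mono) auto
    finally show ?thesis by (simp add: k_def)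
  qed
qed

text \<open>A negative value \<open>- y\<close> has weight at least \<open>\<alpha>\<close>, so \<open>y \<le> T = m / \<alpha>\<close> where \<open>m\<close> is the mean of
  the negative part. The two bounds above show that the worst case has all of it at \<open>- T\<close> with
  weight \<open>\<alpha>\<close> and everything else at a single positive point.\<close>

lemma sum_gexp_le_one:
  fixes p x :: "'i \<Rightarrow> real"
  assumes a: "0 < \<alpha>" "\<alpha> \<le> 1/2" and I: "finite I"
    and p: "\<And>i. i \<in> I \<Longrightarrow> \<alpha> \<le> p i" and total: "(\<Sum>i\<in>I. p i) = 1"
    and mean: "(\<Sum>i\<in>I. p i * x i) = 0"
  shows "(\<Sum>i\<in>I. p i * gexp \<alpha> (x i)) \<le> 1"
proof -
  define J where "J = {i\<in>I. x i < 0}"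
  define K where "K = {i\<in>I. 0 \<le> x i}"
  have fin: "finite J" "finite K" and IJK: "I = J \<union> K" "J \<inter> K = {}"
    using I by (auto simp: J_def K_def)
  have split: "(\<Sum>i\<in>I. h i) = (\<Sum>i\<in>J. h i) + (\<Sum>i\<in>K. h i)" for h :: "'i \<Rightarrow> real"
    unfolding IJK(1) by (rule sum.union_disjoint[OF fin IJK(2)])
  have pJ: "\<alpha> \<le> p i" "0 \<le> p i" if "i \<in> J" for i using that p[of i] a by (auto simp: J_def)
  have pK: "\<alpha> \<le> p i" "0 \<le> p i" if "i \<in> K" for i using that p[of i] a by (auto simp: K_def)
  define m where "m = (\<Sum>i\<in>K. p i * x i)"
  have mJ: "(\<Sum>i\<in>J. p i * (- x i)) = m"
    using mean unfolding split by (simp add: m_def sum_negf)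
  define N where "N = sum p J"
  define P where "P = sum p K"
  have NP: "N + P = 1" using total split[of p] by (simp add: N_def P_def)
  show ?thesis
  proof (cases "J = {}")
    \<comment> \<open>Without negative values, mean zero forces every value to be 0.\<close>
    case True
    then have nonneg: "0 \<le> p i * x i" if "i \<in> K" for i
      using that pK[of i] by (auto simp: K_def)
    have "m = 0" using mJ True by simp
    then have "\<forall>i\<in>K. p i * x i = 0"
      unfolding m_def using sum_nonneg_eq_0_iff[OF fin(2) nonneg] by simp
    then have "x i = 0" if "i \<in> K" for i using that pK[of i] a by force
    then show ?thesis using total True by (simp add: IJK)
  next
    case False
    define T where "T = m / \<alpha>"
    \<comment> \<open>By \<open>gexp_neg_ratio\<close>, one \<open>r\<close> serves all negative
      values - y: gexp (- y) \<le> 1 - y + y * r.\<close>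
    define r where "r = max 0 ((gexp \<alpha> (- T) - 1 + T) / T)"
    have yT: "0 < - x i" "- x i \<le> T" if "i \<in> J" for i
    proof -
      show pos: "0 < - x i" using that by (simp add: J_def)
      have "\<alpha> * - x i \<le> p i * (- x i)" using pos pJ[OF that] by (intro mult_right_mono) auto
      also have "\<dots> \<le> (\<Sum>i\<in>J. p i * (- x i))"
        using that fin pJ by (intro member_le_sum) (auto simp: J_def mult_nonneg_nonpos)
      finally show "- x i \<le> T" using a mJ by (simp add: T_def field_simps)
    qed
    obtain i0 where i0: "i0 \<in> J" using False by auto
    have T: "T > 0" using yT[OF i0] by simp
    have m: "m = \<alpha> * T" using a by (simp add: T_def)
    have P: "P \<le> 1 - \<alpha>"
    proof -
      have "p i0 \<le> N" unfolding N_def using i0 fin pJ by (intro member_le_sum) auto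
      with pJ[OF i0] NP show ?thesis by simp
    qed
    have "(\<Sum>i\<in>J. p i * gexp \<alpha> (x i)) \<le> (\<Sum>i\<in>J. p i * (1 - (- x i) + (- x i) * r))"
      using gexp_neg_ratio[OF a yT] pJ
      by (intro sum_mono mult_left_mono) (auto simp: r_def algebra_simps)
    also have "\<dots> = (\<Sum>i\<in>J. p i - p i * (- x i) + (p i * (- x i)) * r)"
      by (simp add: algebra_simps)
    also have "\<dots> = N - m + m * r"
      by (simp only: sum.distrib sum_subtractf sum_distrib_right[symmetric] mJ N_def)
    finally have neg: "(\<Sum>i\<in>J. p i * gexp \<alpha> (x i)) \<le> N - m + m * r" .
    show ?thesis
    proof (cases "gexp \<alpha> (- T) - 1 + T \<le> 0")
      \<comment> \<open>With \<open>r\<close> = 0 the bounds 1 + x on both sides add up to (N - m) +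
        (P + m) = 1.\<close>
      case True
      then have "r = 0" using T by (simp add: r_def max_def field_simps)
      moreover have "(\<Sum>i\<in>K. p i * gexp \<alpha> (x i)) \<le> (\<Sum>i\<in>K. p i * (1 + x i))"
        using gexp_le_one_plus[OF a] pK by (intro sum_mono mult_left_mono) (auto simp: K_def)
      moreover have "(\<Sum>i\<in>K. p i * (1 + x i)) = P + m"
        by (simp add: algebra_simps sum.distrib P_def m_def)
      ultimately show ?thesis using neg NP by (simp add: split)
    next
      case False
      then have "r = (gexp \<alpha> (- T) - 1 + T) / T" using T by (simp add: r_def max_def field_simps)
      then have "T * r = gexp \<alpha> (- T) - 1 + T" using T by simp
      \<comment> \<open>The bound \<open>neg\<close> now reads \<alpha> * gexp (- T) + (N -
        \<alpha>): weight \<alpha> sits at - T and the rest of the negative weight has moved to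
        0.\<close>
      then have mr: "m * r = \<alpha> * gexp \<alpha> (- T) - \<alpha> + m"
        unfolding m mult.assoc by (simp only:) (simp add: algebra_simps)
      \<comment> \<open>The positive value that, with weight 1 - \<alpha>, balances - T with weight
        \<alpha>.\<close>
      define \<xi> where "\<xi> = \<alpha> * T / (1 - \<alpha>)"
      have \<xi>: "0 \<le> \<xi>" "(1 - \<alpha>) * \<xi> = m" using a T by (auto simp: \<xi>_def m)
      define g where "g = gexp \<alpha> (min \<xi> (2 * \<alpha>))"
      obtain l where l: "\<And>x. 0 \<le> x \<Longrightarrow> gexp \<alpha> x \<le> g + l * (x - \<xi>)"
        using gexp_support_line[OF a \<xi>(1)] unfolding g_def by blast
      have "(\<Sum>i\<in>K. p i * gexp \<alpha> (x i)) \<le> (\<Sum>i\<in>K. p i * (g + l * (x i - \<xi>)))"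
        using l pK by (intro sum_mono mult_left_mono) (auto simp: K_def)
      also have "\<dots> = (\<Sum>i\<in>K. p i * (g - l * \<xi>) + l * (p i * x i))"
        by (simp add: algebra_simps)
      also have "\<dots> = P * (g - l * \<xi>) + l * m"
        by (simp only: sum.distrib sum_distrib_right[symmetric] sum_distrib_left[symmetric] P_def m_def)
      finally have pos: "(\<Sum>i\<in>K. p i * gexp \<alpha> (x i)) \<le> P * (g - l * \<xi>) + l * m" .
      \<comment> \<open>The weight N - \<alpha> = 1 - \<alpha> - P moved to 0 counts with gexp 0 =
        1, and the support line is at least 1 there. So the line bounds the whole weight 1 -
        \<alpha>.\<close>
      have "(1 - \<alpha> - P) * 1 \<le> (1 - \<alpha> - P) * (g - l * \<xi>)"
        using l[of 0] P by (intro mult_left_mono) auto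
      moreover have "(1 - \<alpha> - P) * (g - l * \<xi>) + P * (g - l * \<xi>) + l * m = (1 - \<alpha>) * g"
        unfolding \<xi>(2)[symmetric] by (simp add: algebra_simps)
      moreover have "\<alpha> * gexp \<alpha> (- T) + (1 - \<alpha>) * g \<le> 1"
        using gexp_two_point[OF a, of T] T by (simp add: g_def \<xi>_def)
      ultimately show ?thesis using neg pos mr NP by (simp add: split)
    qed
  qed
qed

section \<open>Homogeneous filtrations\<close>

locale homogeneous_filtration = prob_space M
  for M :: "'a measure" and F D :: "nat \<Rightarrow> 'a set set" and \<alpha> :: real +
  assumes filtration: "atomic_filtration M F D"
    and \<alpha>_pos: "0 < \<alpha>" and \<alpha>_le: "\<alpha> \<le> 1/2"
    and homogeneous: "homogeneous M D \<alpha>"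
begin

section \<open>Cubes: nesting, lower bounds on their measure, finiteness\<close>

lemma F_sigma: "sigma_algebra (space M) (F n)"
  and F_sets: "F n \<subseteq> sets M"
  and F_Suc: "F n \<subseteq> F (Suc n)"
  and F_0: "F 0 = {{}, space M}"
  and sets_eq: "sets M = sigma_sets (space M) (\<Union>n. F n)"
  and D_countable: "countable (D n)"
  and D_disjoint: "disjoint (D n)"
  and D_F: "D n \<subseteq> F n"
  and F_Union: "A \<in> F n \<Longrightarrow> \<exists>C\<subseteq>D n. A = \<Union>C"
  using filtration by (auto simp: atomic_filtration_def)

lemma F_mono: "m \<le> n \<Longrightarrow> F m \<subseteq> F n"
  by (rule lift_Suc_mono_le[of F]) (use F_Suc in auto)

lemma cube_sets [measurable]: "Q \<in> D n \<Longrightarrow> Q \<in> sets M"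
  using D_F F_sets by blast

lemma cube_unique: "Q \<in> D n \<Longrightarrow> R \<in> D n \<Longrightarrow> x \<in> Q \<Longrightarrow> x \<in> R \<Longrightarrow> Q = R"
  using D_disjoint[of n] by (auto simp: disjoint_def)

lemma cube_subset_of_meet:
  assumes "A \<in> F n" "R \<in> D n" "x \<in> A" "x \<in> R"
  shows "R \<subseteq> A"
  using F_Union[OF assms(1)] assms cube_unique by blast

lemma cubes_cover: "\<Union>(D n) = space M"
proof
  show "\<Union>(D n) \<subseteq> space M" using cube_sets sets.sets_into_space by blast
  interpret sigma_algebra "space M" "F n" by (rule F_sigma)
  show "space M \<subseteq> \<Union>(D n)" using F_Union[OF top] by blast
qed

lemma obtain_cube:
  assumes "x \<in> space M" obtains Q where "Q \<in> D n" "x \<in> Q"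
  using assms cubes_cover by blast

lemma cube_eq_Union_children:
  assumes "Q \<in> D n" shows "Q = \<Union>(children D n Q)"
proof -
  have "Q \<in> F (Suc n)" using assms D_F F_Suc by blast
  from F_Union[OF this] show ?thesis by (auto simp: children_def)
qed

lemma exists_cube_pos: "\<exists>Q\<in>D n. measure M Q > 0"
proof (rule ccontr)
  assume "\<not> ?thesis"
  then have "Q \<in> null_sets M" if "Q \<in> D n" for Q
    using that cube_sets[OF that] by (auto simp: null_sets_def emeasure_eq_measure not_less measure_le_0_iff)
  then have "\<Union>(D n) \<in> null_sets M"
    using D_countable by (metis null_sets_UN' image_ident)
  then show False using cubes_cover[of n] emeasure_space_1 by (auto simp: null_sets_def)
qed

lemma empty_notin_cubes: "{} \<notin> D (Suc n)"
proof
  assume e: "{} \<in> D (Suc n)"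
  obtain Q where Q: "Q \<in> D n" "measure M Q > 0" using exists_cube_pos by blast
  have "{} \<in> children D n Q" using e by (simp add: children_def)
  then have "\<alpha> * measure M Q \<le> measure M {}"
    using homogeneous Q(1) unfolding homogeneous_def by blast
  moreover have "\<alpha> * measure M Q > 0" using Q \<alpha>_pos by simp
  ultimately show False by simp
qed

text \<open>Each passage from parent to child costs at most a factor \<alpha>. The empty set is
  excluded because \<open>D 0\<close> may contain it.\<close>

lemma cube_measure_ge: "Q \<in> D n \<Longrightarrow> Q \<noteq> {} \<Longrightarrow> \<alpha> ^ n \<le> measure M Q"
proof (induction n arbitrary: Q)
  case 0
  then have "Q = space M" using D_F[of 0] F_0 by blast
  then show ?case by (simp add: prob_space)
next
  case (Suc n)
  then obtain x where x: "x \<in> Q" by blast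
  have "x \<in> space M" using Suc.prems x cubes_cover by blast
  then obtain P where P: "P \<in> D n" "x \<in> P" by (rule obtain_cube)
  have "P \<in> F (Suc n)" using P D_F F_Suc by blast
  then have "Q \<in> children D n P"
    using cube_subset_of_meet Suc.prems P x by (auto simp: children_def)
  then have "\<alpha> * measure M P \<le> measure M Q"
    using homogeneous P by (auto simp: homogeneous_def)
  moreover have "\<alpha> ^ n \<le> measure M P" using Suc.IH P by blast
  then have "\<alpha> * \<alpha> ^ n \<le> \<alpha> * measure M P" using \<alpha>_pos by simp
  ultimately show ?case by simp
qed

lemma cube_pos: "Q \<in> D n \<Longrightarrow> x \<in> Q \<Longrightarrow> measure M Q > 0"
  using cube_measure_ge[of Q n] \<alpha>_pos by (auto intro: less_le_trans[OF zero_less_power])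

text \<open>The nonempty cubes of generation n are disjoint, each of measure at least \<alpha>^n,
  inside a space of measure 1. Hence sums over cubes and over children are finite sums from here
  on.\<close>

lemma finite_cubes: "finite (D n)"
proof (rule ccontr)
  assume "infinite (D n)"
  then have "infinite (D n - {{}})" by simp
  obtain N :: nat where N: "1 / \<alpha> ^ n < N" using reals_Archimedean2 by blast
  obtain B where B: "finite B" "card B = N" "B \<subseteq> D n - {{}}"
    using infinite_arbitrarily_large[OF \<open>infinite (D n - {{}})\<close>] by blast
  have "disjoint B" using D_disjoint[of n] B(3) by (auto simp: disjoint_def)
  have "N * \<alpha> ^ n = (\<Sum>Q\<in>B. \<alpha> ^ n)" using B by simp
  also have "\<dots> \<le> (\<Sum>Q\<in>B. measure M Q)"
    using B by (intro sum_mono cube_measure_ge) auto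
  also have "\<dots> = measure M (\<Union>Q\<in>B. Q)"
    using B cube_sets \<open>disjoint B\<close>
    by (intro finite_measure_finite_Union[symmetric])
      (auto simp: disjoint_family_on_def disjoint_def)
  also have "\<dots> \<le> 1" by simp
  finally show False using N \<alpha>_pos by (simp add: field_simps)
qed

lemma finite_children: "finite (children D n Q)"
  using finite_cubes by (simp add: children_def)

lemma child_cube: "R \<in> children D n Q \<Longrightarrow> R \<in> D (Suc n)"
  by (simp add: children_def)

section \<open>Integrals over cubes and conditional expectations\<close>

lemma integral_split_cubes:
  fixes g :: "'a \<Rightarrow> real"
  assumes "integrable M g"
  shows "(\<integral>x. g x \<partial>M) = (\<Sum>Q\<in>D n. LINT x:Q|M. g x)"
proof -
  have "(\<integral>x. g x \<partial>M) = (LINT x:(\<Union>Q\<in>D n. Q)|M. g x)"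
    using assms by (simp add: cubes_cover set_integral_space)
  also have "\<dots> = (\<Sum>Q\<in>D n. LINT x:Q|M. g x)"
    using D_disjoint[of n] assms
    by (intro set_integral_finite_Union finite_cubes cube_sets)
      (auto simp: disjoint_family_on_def disjoint_def set_integrable_def cube_sets
        intro!: integrable_mult_indicator[where 'b=real, simplified])
  finally show ?thesis .
qed

lemma set_integral_split_children:
  fixes g :: "'a \<Rightarrow> real"
  assumes "integrable M g" "Q \<in> D n"
  shows "(LINT x:Q|M. g x) = (\<Sum>R\<in>children D n Q. LINT x:R|M. g x)"
proof -
  have "(LINT x:Q|M. g x) = (LINT x:(\<Union>R\<in>children D n Q. R)|M. g x)"
    using cube_eq_Union_children[OF assms(2)] by simp
  also have "\<dots> = (\<Sum>R\<in>children D n Q. LINT x:R|M. g x)"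
    using D_disjoint[of "Suc n"] assms
    by (intro set_integral_finite_Union finite_children)
      (auto simp: disjoint_family_on_def disjoint_def set_integrable_def cube_sets children_def
        intro!: integrable_mult_indicator[where 'b=real, simplified])
  finally show ?thesis .
qed

text \<open>The conditional expectation of \<open>f\<close> given \<open>F n\<close>; at each point
  only the cube containing it contributes.\<close>

definition cexp :: "nat \<Rightarrow> ('a \<Rightarrow> real) \<Rightarrow> 'a \<Rightarrow> real" where
  "cexp n f x = (\<Sum>Q\<in>D n. cubeE M Q f x)"

lemma cexp_eq_avg:
  assumes "Q \<in> D n" "x \<in> Q"
  shows "cexp n f x = avg M Q f"
proof -
  have "cexp n f x = (\<Sum>R\<in>D n. if R = Q then avg M Q f else 0)"
    unfolding cexp_def cubeE_def
    using assms cube_unique by (intro sum.cong) (auto simp: indicator_def)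
  then show ?thesis using finite_cubes assms by simp
qed

lemma cexp_measurable [measurable]: "cexp n f \<in> borel_measurable M"
  unfolding cexp_def cubeE_def by measurable

lemma avg_mult:
  assumes "Q \<in> D n" shows "avg M Q f * measure M Q = (LINT x:Q|M. f x)"
proof (cases "Q = {}")
  case False
  then have "measure M Q > 0" using cube_pos assms by blast
  then show ?thesis by (simp add: avg_def)
qed (simp add: set_lebesgue_integral_def)

lemma set_integral_const_on_cube:
  fixes c :: real
  assumes "Q \<in> D n" "\<And>x. x \<in> Q \<Longrightarrow> g x = c"
  shows "(LINT x:Q|M. g x) = c * measure M Q"
proof -
  have "(LINT x:Q|M. g x) = (LINT x:Q|M. c)"
    using assms cube_sets by (intro set_lebesgue_integral_cong) auto
  also have "\<dots> = c * measure M Q"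
    using assms cube_sets sets.sets_into_space[OF cube_sets[OF assms(1)]]
    by (simp add: set_lebesgue_integral_def Int_absorb1 Int_absorb2)
  finally show ?thesis .
qed

lemma integrable_cexp: "integrable M (cexp n f)"
  unfolding cexp_def cubeE_def
  by (intro Bochner_Integration.integrable_sum integrable_mult_right)
    (simp add: cube_sets less_top[symmetric])

text \<open>On each cube the modulus of an average is at most the average of the modulus. The
  resulting contraction makes approximation errors uniform in n.\<close>

lemma integral_abs_cexp_le:
  assumes f: "integrable M f"
  shows "(\<integral>x. \<bar>cexp n f x\<bar> \<partial>M) \<le> (\<integral>x. \<bar>f x\<bar> \<partial>M)"
proof -
  have "(\<integral>x. \<bar>cexp n f x\<bar> \<partial>M) = (\<Sum>Q\<in>D n. LINT x:Q|M. \<bar>cexp n f x\<bar>)"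
    by (intro integral_split_cubes integrable_abs integrable_cexp)
  also have "\<dots> \<le> (\<Sum>Q\<in>D n. LINT x:Q|M. \<bar>f x\<bar>)"
  proof (rule sum_mono)
    fix Q assume Q: "Q \<in> D n"
    have "(LINT x:Q|M. \<bar>cexp n f x\<bar>) = \<bar>avg M Q f\<bar> * measure M Q"
      by (rule set_integral_const_on_cube[OF Q]) (simp add: cexp_eq_avg[OF Q])
    also have "\<dots> = \<bar>LINT x:Q|M. f x\<bar>"
      by (simp add: abs_mult avg_mult[OF Q, symmetric])
    also have "\<dots> \<le> (LINT x:Q|M. \<bar>f x\<bar>)"
      unfolding set_lebesgue_integral_def
      using integral_abs_bound[of M "\<lambda>x. indicator Q x *\<^sub>R f x"] by (simp add: abs_mult)
    finally show "(LINT x:Q|M. \<bar>cexp n f x\<bar>) \<le> (LINT x:Q|M. \<bar>f x\<bar>)" .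
  qed
  also have "\<dots> = (\<integral>x. \<bar>f x\<bar> \<partial>M)"
    by (intro integral_split_cubes[symmetric] integrable_abs f)
  finally show ?thesis .
qed

lemma set_integrable_cube:
  fixes f :: "'a \<Rightarrow> real"
  shows "integrable M f \<Longrightarrow> Q \<in> D n \<Longrightarrow> set_integrable M Q f"
  by (simp add: set_integrable_def cube_sets integrable_mult_indicator[where 'b=real, simplified])

lemma cexp_add:
  assumes "integrable M f" "integrable M g" "x \<in> space M"
  shows "cexp n (\<lambda>x. f x + g x) x = cexp n f x + cexp n g x"
proof -
  obtain Q where Q: "Q \<in> D n" "x \<in> Q" using obtain_cube assms(3) by blast
  then show ?thesis using assms
    by (simp add: cexp_eq_avg[OF Q] avg_def set_integrable_cube add_divide_distrib)
qed

lemma cexp_diff: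
  assumes "integrable M f" "integrable M g" "x \<in> space M"
  shows "cexp n (\<lambda>x. f x - g x) x = cexp n f x - cexp n g x"
proof -
  obtain Q where Q: "Q \<in> D n" "x \<in> Q" using obtain_cube assms(3) by blast
  then show ?thesis using assms
    by (simp add: cexp_eq_avg[OF Q] avg_def set_integrable_cube diff_divide_distrib)
qed

lemma cexp_scale: "cexp n (\<lambda>x. f x * c) x = cexp n f x * c"
  unfolding cexp_def cubeE_def avg_def sum_distrib_right
  by (intro sum.cong) simp_all

text \<open>A cube of generation n \<ge> m lies inside \<open>A\<close> or misses it, so the
  indicator is constant on it.\<close>

lemma cexp_indicator:
  assumes "A \<in> F m" "m \<le> n" "x \<in> space M"
  shows "cexp n (indicator A) x = indicator A x"
proof -
  obtain Q where Q: "Q \<in> D n" "x \<in> Q" using obtain_cube assms(3) by blast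
  have "A \<in> F n" using F_mono assms by blast
  have c: "indicator A y = (indicator A x :: real)" if "y \<in> Q" for y
    using cube_subset_of_meet[OF \<open>A \<in> F n\<close> Q(1)] Q that by (auto simp: indicator_def)
  have "(LINT y:Q|M. indicator A y) = indicator A x * measure M Q"
    by (rule set_integral_const_on_cube[OF Q(1) c])
  moreover have "measure M Q > 0" using Q cube_pos by blast
  ultimately show ?thesis by (simp add: cexp_eq_avg[OF Q] avg_def)
qed

section \<open>Convergence of the conditional expectations in mean\<close>

definition L1_limit :: "('a \<Rightarrow> real) \<Rightarrow> bool" where
  "L1_limit f \<longleftrightarrow> integrable M f \<and> (\<lambda>n. \<integral>x. \<bar>cexp n f x - f x\<bar> \<partial>M) \<longlonglongrightarrow> 0"

lemma L1_limit_add: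
  assumes "L1_limit f" "L1_limit g"
  shows "L1_limit (\<lambda>x. f x + g x)"
proof -
  have i: "integrable M f" "integrable M g" using assms by (auto simp: L1_limit_def)
  have "(\<lambda>n. \<integral>x. \<bar>cexp n (\<lambda>x. f x + g x) x - (f x + g x)\<bar> \<partial>M) \<longlonglongrightarrow> 0"
  proof (rule tendsto_sandwich[OF _ _ tendsto_const])
    show "\<forall>\<^sub>F n in sequentially. (\<integral>x. \<bar>cexp n (\<lambda>x. f x + g x) x - (f x + g x)\<bar> \<partial>M)
        \<le> (\<integral>x. \<bar>cexp n f x - f x\<bar> \<partial>M) + (\<integral>x. \<bar>cexp n g x - g x\<bar> \<partial>M)"
    proof (intro always_eventually allI)
      fix n
      have "(\<integral>x. \<bar>cexp n (\<lambda>x. f x + g x) x - (f x + g x)\<bar> \<partial>M)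
        \<le> (\<integral>x. \<bar>cexp n f x - f x\<bar> + \<bar>cexp n g x - g x\<bar> \<partial>M)"
        using i by (intro integral_mono) (auto simp: cexp_add integrable_cexp)
      also have "\<dots> = (\<integral>x. \<bar>cexp n f x - f x\<bar> \<partial>M) + (\<integral>x. \<bar>cexp n g x - g x\<bar> \<partial>M)"
        using i by (intro Bochner_Integration.integral_add) (auto simp: integrable_cexp)
      finally show "(\<integral>x. \<bar>cexp n (\<lambda>x. f x + g x) x - (f x + g x)\<bar> \<partial>M)
        \<le> (\<integral>x. \<bar>cexp n f x - f x\<bar> \<partial>M) + (\<integral>x. \<bar>cexp n g x - g x\<bar> \<partial>M)" .
    qed
    show "(\<lambda>n. (\<integral>x. \<bar>cexp n f x - f x\<bar> \<partial>M) + (\<integral>x. \<bar>cexp n g x - g x\<bar> \<partial>M)) \<longlonglongrightarrow> 0"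
      using assms by (auto simp: L1_limit_def intro: tendsto_add_zero)
  qed auto
  with i show ?thesis by (simp add: L1_limit_def)
qed

lemma L1_limit_scale:
  assumes "L1_limit f" shows "L1_limit (\<lambda>x. f x * c)"
proof -
  have "(\<integral>x. \<bar>cexp n (\<lambda>x. f x * c) x - f x * c\<bar> \<partial>M) = (\<integral>x. \<bar>cexp n f x - f x\<bar> \<partial>M) * \<bar>c\<bar>" for n
    unfolding cexp_scale by (simp add: left_diff_distrib[symmetric] abs_mult)
  with assms show ?thesis by (auto simp: L1_limit_def intro: tendsto_mult_left_zero)
qed

text \<open>Insert \<open>g i\<close> between \<open>cexp n f\<close> and \<open>f\<close>. By
  contraction the error from f - g i is bounded independently of n, so i can be fixed before
  n.\<close>

lemma L1_limit_closed:
  assumes g: "\<And>i::nat. L1_limit (g i)" and f: "integrable M f"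
    and lim: "(\<lambda>i. \<integral>x. \<bar>f x - g i x\<bar> \<partial>M) \<longlonglongrightarrow> 0"
  shows "L1_limit f"
proof -
  have gi: "integrable M (g i)" for i using g by (simp add: L1_limit_def)
  have bound: "(\<integral>x. \<bar>cexp n f x - f x\<bar> \<partial>M)
      \<le> 2 * (\<integral>x. \<bar>f x - g i x\<bar> \<partial>M) + (\<integral>x. \<bar>cexp n (g i) x - g i x\<bar> \<partial>M)" for n i
  proof -
    have "(\<integral>x. \<bar>cexp n f x - f x\<bar> \<partial>M) \<le>
       (\<integral>x. (\<bar>cexp n (\<lambda>x. f x - g i x) x\<bar> + \<bar>f x - g i x\<bar>) + \<bar>cexp n (g i) x - g i x\<bar> \<partial>M)"
      using f gi by (intro integral_mono) (auto simp: cexp_diff integrable_cexp)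
    also have "\<dots> = (\<integral>x. \<bar>cexp n (\<lambda>x. f x - g i x) x\<bar> + \<bar>f x - g i x\<bar> \<partial>M)
        + (\<integral>x. \<bar>cexp n (g i) x - g i x\<bar> \<partial>M)"
      using f gi by (intro Bochner_Integration.integral_add) (auto simp: integrable_cexp)
    also have "(\<integral>x. \<bar>cexp n (\<lambda>x. f x - g i x) x\<bar> + \<bar>f x - g i x\<bar> \<partial>M)
        = (\<integral>x. \<bar>cexp n (\<lambda>x. f x - g i x) x\<bar> \<partial>M) + (\<integral>x. \<bar>f x - g i x\<bar> \<partial>M)"
      using f gi by (intro Bochner_Integration.integral_add) (auto simp: integrable_cexp)
    also have "(\<integral>x. \<bar>cexp n (\<lambda>x. f x - g i x) x\<bar> \<partial>M) \<le> (\<integral>x. \<bar>f x - g i x\<bar> \<partial>M)"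
      using f gi by (intro integral_abs_cexp_le) auto
    finally show ?thesis by simp
  qed
  have "(\<lambda>n. \<integral>x. \<bar>cexp n f x - f x\<bar> \<partial>M) \<longlonglongrightarrow> 0"
  proof (rule LIMSEQ_I)
    fix e :: real assume e: "e > 0"
    from LIMSEQ_D[OF lim, of "e / 4"] e obtain i where i: "(\<integral>x. \<bar>f x - g i x\<bar> \<partial>M) < e / 4"
      by auto
    have "(\<lambda>n. \<integral>x. \<bar>cexp n (g i) x - g i x\<bar> \<partial>M) \<longlonglongrightarrow> 0"
      using g by (simp add: L1_limit_def)
    from LIMSEQ_D[OF this, of "e / 2"] e obtain N where
      N: "\<And>n. n \<ge> N \<Longrightarrow> (\<integral>x. \<bar>cexp n (g i) x - g i x\<bar> \<partial>M) < e / 2" by auto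
    have "(\<integral>x. \<bar>cexp n f x - f x\<bar> \<partial>M) < e" if "n \<ge> N" for n
      using bound[of n i] i N[OF that] by simp
    then show "\<exists>N. \<forall>n\<ge>N. norm ((\<integral>x. \<bar>cexp n f x - f x\<bar> \<partial>M) - 0) < e" by auto
  qed
  with f show ?thesis by (simp add: L1_limit_def)
qed

lemma L1_limit_dominated:
  assumes g: "\<And>i::nat. L1_limit (g i)" and f: "integrable M f" and w: "integrable M w"
    and lim: "\<And>x. x \<in> space M \<Longrightarrow> (\<lambda>i. g i x) \<longlonglongrightarrow> f x"
    and dom: "\<And>i x. x \<in> space M \<Longrightarrow> \<bar>g i x\<bar> \<le> w x"
  shows "L1_limit f"
proof (rule L1_limit_closed[OF g f])
  have gi: "integrable M (g i)" for i using g by (simp add: L1_limit_def)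
  have "(\<lambda>i. \<integral>x. \<bar>f x - g i x\<bar> \<partial>M) \<longlonglongrightarrow> (\<integral>x. 0 \<partial>M)"
  proof (rule integral_dominated_convergence[where w = "\<lambda>x. \<bar>f x\<bar> + w x"])
    show "AE x in M. (\<lambda>i. \<bar>f x - g i x\<bar>) \<longlonglongrightarrow> 0"
    proof (rule AE_I2)
      fix x assume "x \<in> space M"
      have "(\<lambda>i. \<bar>f x - g i x\<bar>) \<longlonglongrightarrow> \<bar>f x - f x\<bar>"
        by (intro tendsto_intros lim \<open>x \<in> space M\<close>)
      then show "(\<lambda>i. \<bar>f x - g i x\<bar>) \<longlonglongrightarrow> 0" by simp
    qed
    show "AE x in M. norm \<bar>f x - g i x\<bar> \<le> \<bar>f x\<bar> + w x" for i
    proof (rule AE_I2)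
      fix x assume "x \<in> space M"
      from dom[OF this, of i] show "norm \<bar>f x - g i x\<bar> \<le> \<bar>f x\<bar> + w x" by simp
    qed
    show "(\<lambda>x. \<bar>f x - g i x\<bar>) \<in> borel_measurable M" for i
      using borel_measurable_integrable[OF f] borel_measurable_integrable[OF gi[of i]]
      by measurable
  qed (use f w in auto)
  then show "(\<lambda>i. \<integral>x. \<bar>f x - g i x\<bar> \<partial>M) \<longlonglongrightarrow> 0" by simp
qed

lemma L1_limit_cong:
  assumes "L1_limit f" "\<And>x. x \<in> space M \<Longrightarrow> f x = g x"
  shows "L1_limit g"
proof (rule L1_limit_dominated[of "\<lambda>_. f" g "\<lambda>x. \<bar>f x\<bar>"])
  show "integrable M g" using assms Bochner_Integration.integrable_cong[of M M f g] 
    by (auto simp: L1_limit_def)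
qed (use assms in \<open>auto simp: L1_limit_def\<close>)

lemma L1_limit_indicator_F:
  assumes "A \<in> F m" shows "L1_limit (indicator A)"
proof -
  have A: "A \<in> sets M" using assms F_sets by blast
  have "(\<integral>x. \<bar>cexp n (indicator A) x - indicator A x\<bar> \<partial>M) = 0" if "m \<le> n" for n
  proof -
    have "(\<integral>x. \<bar>cexp n (indicator A) x - indicator A x\<bar> \<partial>M) = (\<integral>x. 0 \<partial>M)"
      using cexp_indicator[OF assms that] by (intro Bochner_Integration.integral_cong) auto
    then show ?thesis by simp
  qed
  then have "(\<lambda>n. \<integral>x. \<bar>cexp n (indicator A) x - indicator A x\<bar> \<partial>M) \<longlonglongrightarrow> 0"
    by (intro tendsto_eventually eventually_sequentiallyI[of m])
  then show ?thesis using A by (simp add: L1_limit_def less_top[symmetric])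
qed

text \<open>The sets of all \<open>F n\<close> form an intersection-stable generator, so Dynkin's
  theorem applies; for a disjoint union the partial sums of indicators are dominated by 1.\<close>

lemma L1_limit_indicator:
  assumes "A \<in> sets M" shows "L1_limit (indicator A)"
proof -
  have "Int_stable (\<Union>n. F n)"
  proof (rule Int_stableI)
    fix A B assume "A \<in> (\<Union>n. F n)" "B \<in> (\<Union>n. F n)"
    then obtain m n where "A \<in> F m" "B \<in> F n" by blast
    then have AB: "A \<in> F (max m n)" "B \<in> F (max m n)"
      using F_mono[of m "max m n"] F_mono[of n "max m n"] by auto
    interpret sigma_algebra "space M" "F (max m n)" by (rule F_sigma)
    show "A \<inter> B \<in> (\<Union>n. F n)" using Int[OF AB] by blast
  qed
  moreover have "(\<Union>n. F n) \<subseteq> Pow (space M)"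
    using F_sets sets.sets_into_space by blast
  moreover have "A \<in> sigma_sets (space M) (\<Union>n. F n)" using assms sets_eq by simp
  ultimately show ?thesis
  proof (induction rule: sigma_sets_induct_disjoint)
    case (basic A)
    then show ?case using L1_limit_indicator_F by blast
  next
    case empty
    show ?case using F_0 by (intro L1_limit_indicator_F[of _ 0]) simp
  next
    case (compl A)
    have "L1_limit (\<lambda>x. indicator (space M) x + indicator A x * (- 1))"
      using F_0 by (intro L1_limit_add[OF L1_limit_indicator_F[of _ 0] L1_limit_scale[OF compl(2)]]) simp
    then show ?case by (rule L1_limit_cong) (simp add: indicator_def)
  next
    case (union A)
    have A: "A i \<in> sets M" for i using union(2) sets_eq by blast
    have "L1_limit (\<lambda>x. \<Sum>i<n. indicator (A i) x)" for n
    proof (induction n)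
      case 0
      have "L1_limit (indicator {})" using F_0 by (intro L1_limit_indicator_F[of _ 0]) simp
      then show ?case by (rule L1_limit_cong) simp
    next
      case (Suc n)
      show ?case unfolding sum.lessThan_Suc by (rule L1_limit_add[OF Suc union(3)])
    qed
    then show ?case
    proof (rule L1_limit_dominated[where w = "\<lambda>_. 1"])
      show "integrable M (indicator (\<Union>i. A i) :: 'a \<Rightarrow> real)"
        using A by (intro integrable_real_indicator) (auto simp: less_top[symmetric])
      fix x
      show "(\<lambda>n. \<Sum>i<n. indicator (A i) x) \<longlonglongrightarrow> (indicator (\<Union>i. A i) x :: real)"
        using indicator_sums[of A x] union(1) unfolding sums_def disjoint_family_on_def by blast
      fix n
      have "(\<Sum>i<n. indicator (A i) x) = (indicator (\<Union>i<n. A i) x :: real)"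
        using union(1) by (intro indicator_UN_disjoint[symmetric])
          (auto simp: disjoint_family_on_def)
      then show "\<bar>\<Sum>i<n. indicator (A i) x\<bar> \<le> (1::real)" by (simp add: indicator_def)
    qed simp
  qed
qed

lemma L1_limit_all:
  assumes "integrable M f" shows "L1_limit f"
  using assms
proof (induction rule: integrable_induct)
  case (base A c)
  then show ?case using L1_limit_scale[OF L1_limit_indicator, of A c] by simp
next
  case (add f g)
  then show ?case by (intro L1_limit_add)
next
  case (lim f s)
  then show ?case
    by (intro L1_limit_dominated[of s f "\<lambda>x. 2 * \<bar>f x\<bar>"]) auto
qed

section \<open>Martingale differences and the square function\<close>

lemma cexp_const_on_cube:
  assumes "m \<le> n" "Q \<in> D n" "x \<in> Q" "y \<in> Q"
  shows "cexp m f x = cexp m f y"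
proof -
  have "x \<in> space M" using assms cubes_cover by blast
  then obtain P where P: "P \<in> D m" "x \<in> P" by (rule obtain_cube)
  have "P \<in> F n" using P D_F F_mono assms by blast
  then have "y \<in> P" using cube_subset_of_meet[of P n Q x] assms P by blast
  with P show ?thesis by (simp add: cexp_eq_avg)
qed

text \<open>There are finitely many children, so the infinite sum is a finite one, and only the
  child containing x contributes. What remains is the martingale increment restricted to
  \<open>Q\<close>.\<close>

lemma mdiff_eq:
  assumes Q: "Q \<in> D n" and x: "x \<in> space M"
  shows "mdiff M D n Q f x = (if x \<in> Q then cexp (Suc n) f x - cexp n f x else 0)"
proof (cases "x \<in> Q")
  case False
  then have "cubeE M R f x = 0" if "R \<in> children D n Q" for R
    using that by (auto simp: children_def cubeE_def indicator_def)
  with False show ?thesis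
    by (simp add: mdiff_def infsum_0 cubeE_def)
next
  case True
  then obtain R where R: "R \<in> children D n Q" "x \<in> R" using cube_eq_Union_children[OF Q] by blast
  have "(\<Sum>\<^sub>\<infinity>R\<in>children D n Q. cubeE M R f x) = (\<Sum>S\<in>children D n Q. cubeE M S f x)"
    using finite_children by simp
  also have "\<dots> = (\<Sum>S\<in>children D n Q. if S = R then avg M R f else 0)"
    using R cube_unique[OF child_cube child_cube[OF R(1)]]
    by (intro sum.cong) (auto simp: cubeE_def indicator_def)
  also have "\<dots> = cexp (Suc n) f x"
    using R finite_children cexp_eq_avg[OF child_cube[OF R(1)] R(2)] by simp
  finally show ?thesis using True cexp_eq_avg[OF Q True, of f] by (simp add: mdiff_def cubeE_def)
qed

lemma sq_sum_eq:
  assumes x: "x \<in> space M"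
  shows "sq_sum M D f x = (\<Sum>n. ennreal ((cexp (Suc n) f x - cexp n f x)\<^sup>2))"
  unfolding sq_sum_def
proof (rule suminf_cong)
  fix n
  obtain Q where Q: "Q \<in> D n" "x \<in> Q" using obtain_cube x by blast
  have "(\<integral>\<^sup>+ Q. ennreal ((mdiff M D n Q f x)\<^sup>2) \<partial>count_space (D n))
     = (\<Sum>R\<in>D n. ennreal ((mdiff M D n R f x)\<^sup>2))"
    by (rule nn_integral_count_space_finite[OF finite_cubes])
  also have "\<dots> = (\<Sum>R\<in>D n. if R = Q then ennreal ((cexp (Suc n) f x - cexp n f x)\<^sup>2) else 0)"
    using Q x cube_unique by (intro sum.cong) (auto simp: mdiff_eq)
  also have "\<dots> = ennreal ((cexp (Suc n) f x - cexp n f x)\<^sup>2)"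
    using Q finite_cubes by simp
  finally show "(\<integral>\<^sup>+ Q. ennreal ((mdiff M D n Q f x)\<^sup>2) \<partial>count_space (D n))
     = ennreal ((cexp (Suc n) f x - cexp n f x)\<^sup>2)" .
qed

definition partial_sq :: "nat \<Rightarrow> ('a \<Rightarrow> real) \<Rightarrow> 'a \<Rightarrow> real" where
  "partial_sq n f x = (\<Sum>k<n. (cexp (Suc k) f x - cexp k f x)\<^sup>2)"

text \<open>Finiteness matters because \<open>enn2real\<close> sends \<top> to 0.\<close>

lemma partial_sq_le_square_fun:
  assumes x: "x \<in> space M" and fin: "sq_sum M D f x < \<top>"
  shows "partial_sq n f x \<le> (square_fun M D f x)\<^sup>2"
proof -
  have "ennreal (partial_sq n f x) = (\<Sum>k<n. ennreal ((cexp (Suc k) f x - cexp k f x)\<^sup>2))"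
    unfolding partial_sq_def by (rule sum_ennreal[symmetric]) simp
  also have "\<dots> \<le> sq_sum M D f x"
    unfolding sq_sum_eq[OF x] by (rule sum_le_suminf) auto
  also have "\<dots> = ennreal (enn2real (sq_sum M D f x))" using fin by simp
  finally show ?thesis by (simp add: square_fun_def)
qed

section \<open>The exponential supermartingale and its limit\<close>

definition expo :: "nat \<Rightarrow> ('a \<Rightarrow> real) \<Rightarrow> 'a \<Rightarrow> real" where
  "expo n f x = exp (cexp n f x - partial_sq n f x / (4 * \<alpha>))"

lemma expo_measurable [measurable]: "expo n f \<in> borel_measurable M"
  unfolding expo_def partial_sq_def by measurable

lemma expo_const_on_cube:
  assumes "Q \<in> D n" "x \<in> Q" "y \<in> Q"
  shows "expo n f x = expo n f y"
proof -
  have "partial_sq n f x = partial_sq n f y"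
    unfolding partial_sq_def
    using assms cexp_const_on_cube[of _ n Q x y f]
    by (intro sum.cong) (auto simp: Suc_le_eq less_imp_le)
  then show ?thesis using cexp_const_on_cube[of n n Q x y f] assms by (simp add: expo_def)
qed

lemma expo_Suc: "expo (Suc n) f x = expo n f x * gexp \<alpha> (cexp (Suc n) f x - cexp n f x)"
  by (simp add: expo_def gexp_def partial_sq_def exp_add[symmetric] add_divide_distrib)

text \<open>One positive value per cube and finitely many cubes: the sum of these values is a
  bound.\<close>

lemma integrable_expo: "integrable M (expo n f)"
proof -
  define c where "c Q = expo n f (SOME y. y \<in> Q)" for Q
  have "expo n f x \<le> (\<Sum>Q\<in>D n. c Q)" if x: "x \<in> space M" for x
  proof -
    obtain Q where Q: "Q \<in> D n" "x \<in> Q" using obtain_cube x by blast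
    have "expo n f x = c Q"
      unfolding c_def using Q by (intro expo_const_on_cube) (auto intro: someI)
    also have "\<dots> \<le> (\<Sum>Q\<in>D n. c Q)"
      using Q finite_cubes by (intro member_le_sum) (auto simp: c_def expo_def)
    finally show ?thesis .
  qed
  then show ?thesis
    by (intro integrable_const_bound[where B = "\<Sum>Q\<in>D n. c Q"]) (auto simp: expo_def)
qed

text \<open>On a cube \<open>Q\<close> of generation n, \<open>expo n f\<close> is a constant
  \<open>E\<close>, and the next increment equals \<open>d R\<close> with conditional probability
  \<open>p R\<close> \<ge> \<alpha> and has mean zero. Thus \<open>sum_gexp_le_one\<close> applies
  on each cube separately.\<close>

lemma integral_expo_Suc_le:
  assumes f: "integrable M f"
  shows "(\<integral>x. expo (Suc n) f x \<partial>M) \<le> (\<integral>x. expo n f x \<partial>M)"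
  unfolding integral_split_cubes[OF integrable_expo[of "Suc n" f], of n]
    integral_split_cubes[OF integrable_expo[of n f], of n]
proof (rule sum_mono)
  fix Q assume Q: "Q \<in> D n"
  show "(LINT x:Q|M. expo (Suc n) f x) \<le> (LINT x:Q|M. expo n f x)"
  proof (cases "Q = {}")
    case False
    then obtain x0 where x0: "x0 \<in> Q" by blast
    define E where "E = expo n f x0"
    have E: "E > 0" by (simp add: E_def expo_def)
    have Qpos: "measure M Q > 0" using cube_pos Q x0 by blast
    define p where "p R = measure M R / measure M Q" for R
    define d where "d R = avg M R f - avg M Q f" for R
    have "(LINT x:Q|M. expo (Suc n) f x) = (\<Sum>R\<in>children D n Q. LINT x:R|M. expo (Suc n) f x)"
      by (rule set_integral_split_children[OF integrable_expo Q])
    also have "\<dots> = (\<Sum>R\<in>children D n Q. E * gexp \<alpha> (d R) * measure M R)"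
    proof (rule sum.cong[OF refl])
      fix R assume R: "R \<in> children D n Q"
      show "(LINT x:R|M. expo (Suc n) f x) = E * gexp \<alpha> (d R) * measure M R"
      proof (rule set_integral_const_on_cube[OF child_cube[OF R]])
        fix x assume x: "x \<in> R"
        then have xQ: "x \<in> Q" using R by (auto simp: children_def)
        show "expo (Suc n) f x = E * gexp \<alpha> (d R)"
          unfolding expo_Suc E_def d_def
          using expo_const_on_cube[OF Q xQ x0] cexp_eq_avg[OF Q xQ]
            cexp_eq_avg[OF child_cube[OF R] x] by simp
      qed
    qed
    also have "\<dots> = E * measure M Q * (\<Sum>R\<in>children D n Q. p R * gexp \<alpha> (d R))"
      unfolding sum_distrib_left p_def using Qpos by (intro sum.cong) auto
    also have "\<dots> \<le> E * measure M Q * 1"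
    proof (intro mult_left_mono sum_gexp_le_one[OF \<alpha>_pos \<alpha>_le finite_children])
      show "\<alpha> \<le> p R" if "R \<in> children D n Q" for R
        using homogeneous Q that Qpos by (auto simp: homogeneous_def p_def field_simps)
      have *: "measure M Q = (\<Sum>R\<in>children D n Q. measure M R)"
      proof -
        have "measure M Q = (LINT x:Q|M. 1)"
          using set_integral_const_on_cube[OF Q, of "\<lambda>_. 1" 1] by simp
        also have "\<dots> = (\<Sum>R\<in>children D n Q. LINT x:R|M. 1)"
          by (rule set_integral_split_children[OF _ Q]) simp
        also have "\<dots> = (\<Sum>R\<in>children D n Q. measure M R)"
          using set_integral_const_on_cube[OF child_cube, of _ n Q "\<lambda>_. 1" 1] by simp
        finally show ?thesis .
      qed
      then show total: "(\<Sum>R\<in>children D n Q. p R) = 1"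
        using Qpos by (simp add: p_def sum_divide_distrib[symmetric])
      have "(\<Sum>R\<in>children D n Q. measure M R * avg M R f) = (\<Sum>R\<in>children D n Q. LINT x:R|M. f x)"
        using avg_mult[OF child_cube] by (intro sum.cong) (auto simp: mult.commute)
      also have "\<dots> = measure M Q * avg M Q f"
        using set_integral_split_children[OF f Q] avg_mult[OF Q, of f] by (simp add: mult.commute)
      finally have "(\<Sum>R\<in>children D n Q. measure M R * d R) = 0"
        by (simp add: d_def right_diff_distrib sum_subtractf sum_distrib_right[symmetric] *[symmetric])
      then show "(\<Sum>R\<in>children D n Q. p R * d R) = 0"
        by (simp add: p_def sum_divide_distrib[symmetric])
    qed (use E in auto)
    also have "\<dots> = (LINT x:Q|M. expo n f x)"
      using set_integral_const_on_cube[OF Q, of "expo n f" E] expo_const_on_cube[OF Q _ x0]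
      by (simp add: E_def)
    finally show ?thesis .
  qed (simp add: set_lebesgue_integral_def)
qed

text \<open>At n = 0 the cube containing a point is the whole space, so \<open>cexp 0 f\<close> is
  the mean of \<open>f\<close> and the square sum is empty.\<close>

lemma integral_expo_le:
  assumes f: "integrable M f"
  shows "(\<integral>x. expo n f x \<partial>M) \<le> exp (\<integral>x. f x \<partial>M)"
proof (induction n)
  case 0
  have "expo 0 f x = exp (\<integral>x. f x \<partial>M)" if "x \<in> space M" for x
  proof -
    obtain Q where Q: "Q \<in> D 0" "x \<in> Q" using obtain_cube \<open>x \<in> space M\<close> by blast
    then have "Q = space M" using D_F[of 0] F_0 by blast
    then show ?thesis
      by (simp add: expo_def partial_sq_def cexp_eq_avg[OF Q] avg_def prob_space
          set_integral_space[OF f])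
  qed
  then have "(\<integral>x. expo 0 f x \<partial>M) = (\<integral>x. exp (\<integral>x. f x \<partial>M) \<partial>M)"
    by (intro Bochner_Integration.integral_cong) auto
  then show ?case by (simp add: prob_space)
next
  case (Suc n)
  then show ?case using integral_expo_Suc_le[OF f, of n] by linarith
qed

lemma exp_square_function_bound:
  assumes f: "integrable M f" and fin: "AE x in M. sq_sum M D f x < \<top>"
  shows "(\<integral>\<^sup>+ x. ennreal (exp (f x - (square_fun M D f x)\<^sup>2 / (4 * \<alpha>))) \<partial>M)
           \<le> ennreal (exp (\<integral>x. f x \<partial>M))"
proof -
  have "(\<lambda>n. \<integral>x. norm (cexp n f x - f x) \<partial>M) \<longlonglongrightarrow> 0"
    using L1_limit_all[OF f] by (simp add: L1_limit_def)
  moreover have "integrable M (\<lambda>x. cexp n f x - f x)" for n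
    using f integrable_cexp by auto
  \<comment> \<open>Convergence in mean gives pointwise convergence along a subsequence, which is
    enough for Fatou's lemma.\<close>
  ultimately obtain r :: "nat \<Rightarrow> nat" where
    r: "AE x in M. (\<lambda>n. cexp (r n) f x - f x) \<longlonglongrightarrow> 0"
    using tendsto_L1_AE_subseq[of M "\<lambda>n x. cexp n f x - f x"] by blast
  have "(\<integral>\<^sup>+ x. ennreal (exp (f x - (square_fun M D f x)\<^sup>2 / (4 * \<alpha>))) \<partial>M)
     \<le> (\<integral>\<^sup>+ x. liminf (\<lambda>n. ennreal (expo (r n) f x)) \<partial>M)"
  proof (rule nn_integral_mono_AE)
    show "AE x in M. ennreal (exp (f x - (square_fun M D f x)\<^sup>2 / (4 * \<alpha>)))
        \<le> liminf (\<lambda>n. ennreal (expo (r n) f x))"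
      using r fin AE_space
    proof eventually_elim
      case (elim x)
      define S where "S = (square_fun M D f x)\<^sup>2 / (4 * \<alpha>)"
      have "(\<lambda>n. (cexp (r n) f x - f x) + f x) \<longlonglongrightarrow> 0 + f x"
        using elim(1) by (intro tendsto_intros)
      \<comment> \<open>With the full square function subtracted, the exponentials converge;
        \<open>expo\<close> subtracts only a partial sum and is therefore at least as large.\<close>
      then have "(\<lambda>n. ennreal (exp (cexp (r n) f x - S))) \<longlonglongrightarrow> ennreal (exp (f x - S))"
        by (intro tendsto_ennrealI tendsto_intros) simp
      then have "ennreal (exp (f x - S)) = liminf (\<lambda>n. ennreal (exp (cexp (r n) f x - S)))"
        by (intro lim_imp_Liminf[symmetric]) auto
      also have "\<dots> \<le> liminf (\<lambda>n. ennreal (expo (r n) f x))"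
        using partial_sq_le_square_fun[OF elim(3,2)] \<alpha>_pos
        by (intro Liminf_mono always_eventually allI ennreal_leI)
          (simp add: expo_def S_def divide_right_mono)
      finally show ?case by (simp add: S_def)
    qed
  qed
  also have "\<dots> \<le> liminf (\<lambda>n. \<integral>\<^sup>+ x. ennreal (expo (r n) f x) \<partial>M)"
    by (rule nn_integral_liminf) measurable
  also have "\<dots> \<le> liminf (\<lambda>n. ennreal (exp (\<integral>x. f x \<partial>M)))"
  proof (intro Liminf_mono always_eventually allI)
    fix n
    have "(\<integral>\<^sup>+ x. ennreal (expo (r n) f x) \<partial>M) = ennreal (\<integral>x. expo (r n) f x \<partial>M)"
      by (rule nn_integral_eq_integral[OF integrable_expo]) (simp add: expo_def)
    also have "\<dots> \<le> ennreal (exp (\<integral>x. f x \<partial>M))"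
      by (intro ennreal_leI integral_expo_le f)
    finally show "(\<integral>\<^sup>+ x. ennreal (expo (r n) f x) \<partial>M) \<le> ennreal (exp (\<integral>x. f x \<partial>M))" .
  qed
  also have "\<dots> = ennreal (exp (\<integral>x. f x \<partial>M))" by (simp add: Liminf_const)
  finally show ?thesis .
qed

end

theorem theorem2p1:
  fixes M :: "'a measure" and F D :: "nat \<Rightarrow> 'a set set" and \<alpha> :: real and f :: "'a \<Rightarrow> real"
  assumes "prob_space M"
    and "atomic_filtration M F D"
    and "0 < \<alpha>" and "\<alpha> \<le> 1/2"
    and "homogeneous M D \<alpha>"
    and "integrable M f"
    and "\<exists>C::real. AE x in M. sq_sum M D f x \<le> ennreal C"
  shows "(\<integral>\<^sup>+ x. ennreal (exp (f x - (square_fun M D f x)\<^sup>2 / (4 * \<alpha>))) \<partial>M)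
           \<le> ennreal (exp (\<integral>x. f x \<partial>M))"
proof -
  interpret homogeneous_filtration M F D \<alpha>
    using assms(1-5) by (intro homogeneous_filtration.intro homogeneous_filtration_axioms.intro)
  from assms(7) have "AE x in M. sq_sum M D f x < \<top>"
    by (auto elim!: eventually_mono intro: le_less_trans)
  with assms(6) show ?thesis by (rule exp_square_function_bound)
qed

end
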